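(* Let $L\in\mathbb{R}^{n\times n}$ be the graph Laplacian matrix of a simple, connected, undirected graph on $n$ vertices. Let $(\lambda_1,\mathbf{v}_1),\ldots,(\lambda_c,\mathbf{v}_c)$ be eigenpairs of $L$ with $\lambda_j>0$ and unit eigenvectors $\mathbf{v}_j$, let $V=[\mathbf{v}_1\ \cdots\ \mathbf{v}_c]\in\mathbb{R}^{n\times c}$ (so $V^{\top}\mathbf{1}_n=\mathbf{0}$), let $\delta>0$ and let $\sigma>0$ be a real shift. Let $\mathbf{r}\in\mathbb{R}^n$ satisfy $\mathbf{1}_n^{\top}\mathbf{r}=0$. Fix an index $i\in\{1,\ldots,n\}$, let $\widehat{L}\in\mathbb{R}^{(n-1)\times(n-1)}$ be obtained from $L$ by deleting its $i$th row and column, and let $$\widehat{V}=\begin{bmatrix}V(1{:}i-1,:)\\ V(i+1{:}n,:)\end{bmatrix}\in\mathbb{R}^{(n-1)\times c},\qquad \widehat{\mathbf{r}}=\begin{bmatrix}\mathbf{r}(1{:}i-1)\\ \mathbf{r}(i+1{:}n)\end{bmatrix}\in\mathbb{R}^{n-1}$$ be obtained from $V$ and $\mathbf{r}$ by deleting the $i$th row. Suppose $\widehat{\mathbf{z}}^{\ast}\in\mathbb{R}^{n-1}$ is the solution of the linear system $$\left(\left(\widehat{L}-\sigma\widehat{I}_n\right)+\tfrac{\sigma}{n}\widehat{\mathbf{1}}_n\widehat{\mathbf{1}}_n^{\top}+\delta\widehat{V}\widehat{V}^{\top}\right)\widehat{\mathbf{z}}=\widehat{\mathbf{r}}.$$ Then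 the $n$-vector $$\mathbf{z}^{\ast}:=\begin{bmatrix}\widehat{\mathbf{z}}^{\ast}(1{:}i-1)\\ 0\\ \widehat{\mathbf{z}}^{\ast}(i{:}n-1)\end{bmatrix}-\frac{\widehat{\mathbf{1}}_n^{\top}\widehat{\mathbf{z}}^{\ast}}{n}\,\mathbf{1}_n$$ is a solution of $(L+\delta VV^{\top}-\sigma I_n)\mathbf{z}=\mathbf{r}$ with $\mathbf{1}_n^{\top}\mathbf{z}^{\ast}=0$.
   Context: The graph Laplacian matrix of a simple undirected graph $\mathcal{G}=(\mathcal{V},\mathcal{E})$ with $n$ vertices is $L=D-A$, where $A$ is the adjacency matrix ($A_{jk}=1$ if $jk\in\mathcal{E}$ and $0$ otherwise) and $D$ is the diagonal matrix with $D_{jj}=\sum_{k}A_{jk}$; thus $L^{\top}=L$ and $L\mathbf{1}_n=\mathbf{0}$. $\mathbf{1}_n\in\mathbb{R}^n$ is the all-ones vector, $\widehat{\mathbf{1}}_n:=\mathbf{1}_{n-1}\in\mathbb{R}^{n-1}$, $I_n$ is the $n\times n$ identity matrix and $\widehat{I}_n:=I_{n-1}$. For a vector $\mathbf{v}$, $\mathbf{v}(p{:}q)$ denotes the subvector of its $p$th to $q$th entries (empty if $p>q$); for a matrix $M$, $M(p{:}q,:)$ denotes the submatrix of its rows $p$ to $q$. In the paper's application the shift $\sigma$ is chosen close to the smallest positive eigenvalue of $L+\delta VV^{\top}$. *)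

theory Defs
  imports
    "Graph_Theory.Pair_Digraph"
    "Graph_Theory.Digraph_Component"
    "Jordan_Normal_Form.Char_Poly"
begin

text \<open>
  Graphs are pair graphs of \<^theory>\<open>Graph_Theory.Pair_Digraph\<close>: an undirected edge \<open>jk\<close> is
  represented by the two arcs \<open>(j, k)\<close> and \<open>(k, j)\<close>. The vertex set is meant to be \<open>{0..<n}\<close>,
  so all row, column and vertex indices start at 0.
\<close>

definition adjacency_matrix :: "nat \<Rightarrow> nat pair_pre_digraph \<Rightarrow> real mat" where
  "adjacency_matrix n G = mat n n (\<lambda>(j, k). if (j, k) \<in> parcs G then 1 else 0)"

definition degree_matrix :: "nat \<Rightarrow> nat pair_pre_digraph \<Rightarrow> real mat" where
  "degree_matrix n G = mat_diag n (\<lambda>j. \<Sum>k<n. adjacency_matrix n G $$ (j, k))"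

definition laplacian :: "nat \<Rightarrow> nat pair_pre_digraph \<Rightarrow> real mat" where
  "laplacian n G = degree_matrix n G - adjacency_matrix n G"

definition ones_vec :: "nat \<Rightarrow> real vec" where
  "ones_vec n = vec n (\<lambda>_. 1)"

definition outer_prod :: "real vec \<Rightarrow> real vec \<Rightarrow> real mat" where
  "outer_prod u w = mat (dim_vec u) (dim_vec w) (\<lambda>(j, k). u $ j * w $ k)"

definition vec_delete :: "real vec \<Rightarrow> nat \<Rightarrow> real vec" where
  "vec_delete v i = vec_first v i @\<^sub>v vec_last v (dim_vec v - Suc i)"

text \<open>The new entry ends up at index \<open>i\<close>; the old entries from \<open>i\<close> on move up by one.\<close>

definition vec_insert :: "real vec \<Rightarrow> nat \<Rightarrow> real \<Rightarrow> real vec" where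
  "vec_insert v i a = vec_first v i @\<^sub>v vCons a (vec_last v (dim_vec v - i))"

text \<open>Row deletion only, with the index convention of \<^const>\<open>mat_delete\<close>.\<close>

definition row_delete :: "real mat \<Rightarrow> nat \<Rightarrow> real mat" where
  "row_delete M i = mat (dim_row M - 1) (dim_col M) (\<lambda>(j, k). M $$ (if j < i then j else Suc j, k))"

end

theory Submission
  imports Defs
begin

text \<open>
  Write \<open>S = L + \<delta> V V\<^sup>T\<close>. Two properties of \<open>S\<close> drive the proof: it is symmetric and it
  annihilates the all-ones vector. For \<open>L\<close> the latter holds because the diagonal is the vector of
  row sums of the adjacency matrix; for \<open>V V\<^sup>T\<close> it holds because eigenvectors of the symmetric
  matrix \<open>L\<close> belonging to nonzero eigenvalues are orthogonal to its kernel vector \<open>1\<close>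
  (lemma \<open>eigenvector_orthogonal_kernel\<close>).

  The rest, lemma \<open>grounded_shifted_solve\<close>, concerns an arbitrary such \<open>S\<close>. Let \<open>w\<close> be the
  reduced solution padded with \<open>0\<close> at position \<open>i\<close>, let \<open>s\<close> be its sum, and let
  \<open>z = w - (s/n) 1\<close>. Padding with zero makes column \<open>i\<close> invisible, so that away from row \<open>i\<close> the
  product \<open>S w\<close> is the reduced matrix times the reduced solution. Passing from \<open>w\<close> to \<open>z\<close> does not
  affect \<open>S w\<close>, since \<open>S 1 = 0\<close>, but turns \<open>- \<sigma> w\<close> into \<open>- \<sigma> w + (\<sigma> s / n) 1\<close>; the rank-one
  term of the reduced system is exactly this correction. Hence \<open>(S - \<sigma> I) z\<close> agrees with \<open>r\<close>
  in every row except possibly row \<open>i\<close>. That remaining row comes for free: \<open>S z\<close>, \<open>z\<close> and \<open>r\<close> all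
  have entry sum zero, so the residual has entry sum zero and can have no single nonzero entry.
\<close>

section \<open>Deleting and inserting an index\<close>

text \<open>The library function \<^const>\<open>insert_index\<close> enumerates all indices other than \<open>i\<close>. It is the
  common language for the deletion and insertion operations on vectors and matrices.\<close>

lemma insert_index_less:
  assumes "i < n" "k < n - 1"
  shows "insert_index i k < n"
  using assms by (auto simp: insert_index_def)

lemma obtain_insert_index:
  assumes "i < n" "j < n" "j \<noteq> i"
  obtains k where "k < n - 1" "j = insert_index i k"
proof
  show "delete_index i j < n - 1" using assms by (auto simp: delete_index_def)
  show "j = insert_index i (delete_index i j)" using insert_delete_index[OF assms(3)] by simp
qed

lemma sum_insert_index:
  fixes f :: "nat \<Rightarrow> 'a::comm_monoid_add"
  assumes "i < n"
  shows "(\<Sum>j<n. f j) = f i + (\<Sum>k<n - 1. f (insert_index i k))"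
proof -
  have "insert_index i ` {..<n - 1} = {..<n} - {i}"
    using assms insert_index_less[OF assms]
    by (auto elim!: obtain_insert_index[OF assms])
  then have "(\<Sum>j\<in>{..<n} - {i}. f j) = (\<Sum>k<n - 1. f (insert_index i k))"
    using sum.reindex[OF insert_index_inj_on[of i "{..<n - 1}"], of f] by simp
  then show ?thesis using assms by (simp add: sum.remove[of "{..<n}" i f])
qed

lemma vec_delete_index:
  assumes "x \<in> carrier_vec n" "i < n" "k < n - 1"
  shows "vec_delete x i $ k = x $ insert_index i k"
  using assms by (auto simp: vec_delete_def vec_first_def vec_last_def insert_index_def)

lemma vec_insert_carrier:
  assumes "x \<in> carrier_vec (n - 1)" "i < n"
  shows "vec_insert x i a \<in> carrier_vec n"
  using assms by (intro carrier_vecI) (auto simp: vec_insert_def)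

lemma vec_insert_index:
  assumes "x \<in> carrier_vec (n - 1)" "i < n"
  shows "vec_insert x i a $ i = a"
    and "k < n - 1 \<Longrightarrow> vec_insert x i a $ insert_index i k = x $ k"
  using assms
  by (auto simp: vec_insert_def vec_first_def vec_last_def insert_index_def vec_index_vCons)

lemma mat_delete_insert_index:
  assumes "A \<in> carrier_mat n n" "j < n - 1" "k < n - 1"
  shows "mat_delete A i i $$ (j, k) = A $$ (insert_index i j, insert_index i k)"
  using assms by (auto simp: mat_delete_def insert_index_def)

lemma mat_delete_gram:
  assumes "A \<in> carrier_mat n m" "i < n"
  shows "mat_delete (A * transpose_mat A) i i = row_delete A i * transpose_mat (row_delete A i)"
  using assms
  by (intro eq_matI) (auto simp: mat_delete_def row_delete_def scalar_prod_def)

lemma mat_delete_add_smult: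
  assumes "A \<in> carrier_mat n n" "B \<in> carrier_mat n n" "i < n"
  shows "mat_delete (A + d \<cdot>\<^sub>m B) i i = mat_delete A i i + d \<cdot>\<^sub>m mat_delete B i i"
  using assms by (intro eq_matI) (auto simp: mat_delete_def)

text \<open>A zero at position \<open>i\<close> hides column \<open>i\<close>, so only the reduced matrix acts.\<close>

lemma mult_vec_insert_zero:
  fixes A :: "real mat"
  assumes A: "A \<in> carrier_mat n n" and x: "x \<in> carrier_vec (n - 1)" and i: "i < n"
    and k: "k < n - 1"
  shows "(A *\<^sub>v vec_insert x i 0) $ insert_index i k = (mat_delete A i i *\<^sub>v x) $ k"
proof -
  let ?w = "vec_insert x i 0"
  have j: "insert_index i k < n" using insert_index_less[OF i k] .
  have "(A *\<^sub>v ?w) $ insert_index i k = (\<Sum>l<n. A $$ (insert_index i k, l) * ?w $ l)"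
    using A j vec_insert_carrier[OF x i, of 0]
    by (auto simp: scalar_prod_def atLeast0LessThan)
  also have "\<dots> = (\<Sum>l<n - 1. A $$ (insert_index i k, insert_index i l) * x $ l)"
    by (simp add: sum_insert_index[OF i] vec_insert_index[OF x i])
  also have "\<dots> = (\<Sum>l<n - 1. mat_delete A i i $$ (k, l) * x $ l)"
    by (simp add: mat_delete_insert_index[OF A k])
  also have "\<dots> = (mat_delete A i i *\<^sub>v x) $ k"
    using A x k by (auto simp: scalar_prod_def atLeast0LessThan mat_delete_def)
  finally show ?thesis .
qed

section \<open>Entry sums\<close>

lemma ones_vec_carrier [simp]: "ones_vec n \<in> carrier_vec n"
  by (simp add: ones_vec_def)

lemma dim_ones_vec [simp]: "dim_vec (ones_vec n) = n"
  by (simp add: ones_vec_def)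

lemma ones_vec_index [simp]: "j < n \<Longrightarrow> ones_vec n $ j = 1"
  by (simp add: ones_vec_def)

lemma ones_vec_scalar_prod:
  assumes "x \<in> carrier_vec n"
  shows "ones_vec n \<bullet> x = (\<Sum>j<n. x $ j)"
  using assms by (auto simp: scalar_prod_def ones_vec_def atLeast0LessThan)

lemma sum_vec_insert_zero:
  assumes "x \<in> carrier_vec (n - 1)" "i < n"
  shows "ones_vec n \<bullet> vec_insert x i 0 = ones_vec (n - 1) \<bullet> x"
  using assms
  by (simp add: ones_vec_scalar_prod vec_insert_carrier sum_insert_index vec_insert_index)

lemma outer_prod_ones_mult:
  assumes "x \<in> carrier_vec m" "k < m"
  shows "(outer_prod (ones_vec m) (ones_vec m) *\<^sub>v x) $ k = ones_vec m \<bullet> x"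
  using assms by (auto simp: outer_prod_def ones_vec_def scalar_prod_def)

text \<open>Two vectors that differ in at most one entry and have the same entry sum coincide. This
  recovers the equation whose row was deleted.\<close>

lemma eq_vec_if_sum_eq:
  assumes x: "x \<in> carrier_vec n" and y: "y \<in> carrier_vec n" and i: "i < n"
    and off: "\<And>k. k < n - 1 \<Longrightarrow> x $ insert_index i k = y $ insert_index i k"
    and sum: "ones_vec n \<bullet> x = ones_vec n \<bullet> y"
  shows "x = y"
proof (rule eq_vecI)
  have "x $ i = y $ i"
    using sum off by (simp add: ones_vec_scalar_prod[OF x] ones_vec_scalar_prod[OF y]
        sum_insert_index[OF i])
  then show "x $ j = y $ j" if "j < dim_vec y" for j
    using that y off by (cases "j = i") (auto elim: obtain_insert_index[OF i])
qed (use x y in auto)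

section \<open>Symmetric matrices that annihilate the all-ones vector\<close>

lemma smult_zero_vec_real: "(a :: real) \<cdot>\<^sub>v 0\<^sub>v n = 0\<^sub>v n"
  by (intro eq_vecI) auto

text \<open>Moving a symmetric matrix across the scalar product gives
  \<open>\<lambda> (u \<bullet> x) = u \<bullet> A x = A u \<bullet> x = 0\<close>.\<close>

lemma eigenvector_orthogonal_kernel:
  fixes A :: "real mat"
  assumes A: "A \<in> carrier_mat n n" and sym: "transpose_mat A = A"
    and u: "u \<in> carrier_vec n" and ker: "A *\<^sub>v u = 0\<^sub>v n"
    and ev: "eigenvector A x l" and l: "l \<noteq> 0"
  shows "x \<bullet> u = 0"
proof -
  have x: "x \<in> carrier_vec n" and Ax: "A *\<^sub>v x = l \<cdot>\<^sub>v x"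
    using ev A by (auto simp: eigenvector_def)
  have "l * (u \<bullet> x) = u \<bullet> (A *\<^sub>v x)" using u x by (simp add: Ax)
  also have "\<dots> = (A *\<^sub>v u) \<bullet> x" using transpose_vec_mult_scalar[OF A x u] sym by simp
  also have "\<dots> = 0" using x ker by simp
  finally show ?thesis using l comm_scalar_prod[OF u x] by simp
qed

text \<open>Fixing coordinate \<open>i\<close> of the unknown to \<open>0\<close> replaces the solution orthogonal to \<open>1\<close> by a
  translate of it along \<open>1\<close>. The kernel condition makes this translation harmless for \<open>S\<close>, and the
  rank-one term compensates its effect on the shift \<open>\<sigma> I\<close>. Symmetry enters only through
  \<open>1 \<bullet> S z = S 1 \<bullet> z = 0\<close>, which supplies the deleted equation.\<close>

lemma grounded_shifted_solve:
  fixes S :: "real mat" and r zhat :: "real vec" and \<sigma> :: real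
  assumes S: "S \<in> carrier_mat n n" and sym: "transpose_mat S = S"
    and ker: "S *\<^sub>v ones_vec n = 0\<^sub>v n"
    and r: "r \<in> carrier_vec n" and r_sum: "ones_vec n \<bullet> r = 0"
    and i: "i < n" and zhat: "zhat \<in> carrier_vec (n - 1)"
    and system: "(mat_delete S i i - \<sigma> \<cdot>\<^sub>m 1\<^sub>m (n - 1)
        + (\<sigma> / real n) \<cdot>\<^sub>m outer_prod (ones_vec (n - 1)) (ones_vec (n - 1))) *\<^sub>v zhat
        = vec_delete r i"
    and z: "z = vec_insert zhat i 0 - ((ones_vec (n - 1) \<bullet> zhat) / real n) \<cdot>\<^sub>v ones_vec n"
  shows "(S - \<sigma> \<cdot>\<^sub>m 1\<^sub>m n) *\<^sub>v z = r" and "ones_vec n \<bullet> z = 0"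
proof -
  let ?w = "vec_insert zhat i 0"
  let ?e = "ones_vec (n - 1)"
  let ?J = "outer_prod ?e ?e"
  define s where "s = ?e \<bullet> zhat"
  have w: "?w \<in> carrier_vec n" using vec_insert_carrier[OF zhat i] .
  have zw: "z = ?w - (s / real n) \<cdot>\<^sub>v ones_vec n" unfolding z s_def ..
  have zc: "z \<in> carrier_vec n" unfolding zw using w by simp
  have "ones_vec n \<bullet> ones_vec n = real n"
    by (simp add: ones_vec_scalar_prod[OF ones_vec_carrier])
  then show z_sum: "ones_vec n \<bullet> z = 0"
    unfolding zw using w i sum_vec_insert_zero[OF zhat i]
    by (simp add: scalar_prod_minus_distrib[of _ n] s_def)
  have Sz: "S *\<^sub>v z = S *\<^sub>v ?w"
    unfolding zw using S w ker mult_mat_vec_carrier[OF S w]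
    by (simp add: mult_minus_distrib_mat_vec[OF S w] mult_mat_vec[OF S] smult_zero_vec_real)
  have smult_one: "(a \<cdot>\<^sub>m 1\<^sub>m m) *\<^sub>v x = a \<cdot>\<^sub>v x" if "x \<in> carrier_vec m" for a m and x :: "real vec"
    using that by (intro eq_vecI) auto
  have shift: "(S - \<sigma> \<cdot>\<^sub>m 1\<^sub>m n) *\<^sub>v z = S *\<^sub>v z - \<sigma> \<cdot>\<^sub>v z"
    using S zc by (simp add: minus_mult_distrib_mat_vec[OF S] smult_one)
  show "(S - \<sigma> \<cdot>\<^sub>m 1\<^sub>m n) *\<^sub>v z = r"
  proof (rule eq_vec_if_sum_eq[OF _ r i])
    show "(S - \<sigma> \<cdot>\<^sub>m 1\<^sub>m n) *\<^sub>v z \<in> carrier_vec n"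
      unfolding shift using mult_mat_vec_carrier[OF S zc] zc by simp
  next
    fix k assume k: "k < n - 1"
    have j: "insert_index i k < n" using insert_index_less[OF i k] .
    have Sh: "mat_delete S i i \<in> carrier_mat (n - 1) (n - 1)"
      using S by (simp add: mat_delete_def)
    have J: "?J \<in> carrier_mat (n - 1) (n - 1)" by (simp add: outer_prod_def ones_vec_def)
    have smult_J: "((\<sigma> / real n) \<cdot>\<^sub>m ?J) *\<^sub>v zhat = (\<sigma> / real n) \<cdot>\<^sub>v (?J *\<^sub>v zhat)"
      using J zhat by (intro eq_vecI) auto
    have Sh_shift: "mat_delete S i i - \<sigma> \<cdot>\<^sub>m 1\<^sub>m (n - 1) \<in> carrier_mat (n - 1) (n - 1)"
      by (intro minus_carrier_mat smult_carrier_mat one_carrier_mat)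
    have "(mat_delete S i i - \<sigma> \<cdot>\<^sub>m 1\<^sub>m (n - 1)) *\<^sub>v zhat = mat_delete S i i *\<^sub>v zhat - \<sigma> \<cdot>\<^sub>v zhat"
      unfolding smult_one[OF zhat, symmetric]
      by (rule minus_mult_distrib_mat_vec[OF Sh _ zhat]) simp
    then have "vec_delete r i
        = mat_delete S i i *\<^sub>v zhat - \<sigma> \<cdot>\<^sub>v zhat + (\<sigma> / real n) \<cdot>\<^sub>v (?J *\<^sub>v zhat)"
      using system add_mult_distrib_mat_vec[OF Sh_shift smult_carrier_mat[OF J] zhat] smult_J
      by metis
    then have "r $ insert_index i k
        = (mat_delete S i i *\<^sub>v zhat - \<sigma> \<cdot>\<^sub>v zhat + (\<sigma> / real n) \<cdot>\<^sub>v (?J *\<^sub>v zhat)) $ k"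
      using vec_delete_index[OF r i k] by simp
    also have "\<dots> = (mat_delete S i i *\<^sub>v zhat) $ k - \<sigma> * zhat $ k + \<sigma> / real n * s"
      using k zhat Sh J outer_prod_ones_mult[OF zhat k] by (simp add: s_def)
    \<comment> \<open>Here the entry \<open>- s/n\<close> of the translation absorbs the rank-one term.\<close>
    also have "\<dots> = (S *\<^sub>v z) $ insert_index i k - \<sigma> * z $ insert_index i k"
      unfolding Sz mult_vec_insert_zero[OF S zhat i k] using w j vec_insert_index[OF zhat i] k
      by (simp add: zw algebra_simps)
    also have "\<dots> = ((S - \<sigma> \<cdot>\<^sub>m 1\<^sub>m n) *\<^sub>v z) $ insert_index i k"
      unfolding shift using S zc j by simp
    finally show "((S - \<sigma> \<cdot>\<^sub>m 1\<^sub>m n) *\<^sub>v z) $ insert_index i k = r $ insert_index i k" ..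
  next
    have "ones_vec n \<bullet> (S *\<^sub>v z) = (S *\<^sub>v ones_vec n) \<bullet> z"
      using transpose_vec_mult_scalar[OF S zc ones_vec_carrier] sym by simp
    then show "ones_vec n \<bullet> ((S - \<sigma> \<cdot>\<^sub>m 1\<^sub>m n) *\<^sub>v z) = ones_vec n \<bullet> r"
      unfolding shift using S zc z_sum r_sum ker
      by (simp add: scalar_prod_minus_distrib[of _ n])
  qed
qed

section \<open>The deflated graph Laplacian\<close>

lemma laplacian_carrier: "laplacian n G \<in> carrier_mat n n"
  by (auto simp: laplacian_def degree_matrix_def adjacency_matrix_def mat_diag_def)

lemma laplacian_symmetric:
  assumes "pair_graph G"
  shows "transpose_mat (laplacian n G) = laplacian n G"
proof -
  interpret pair_graph G by fact
  have "(j, k) \<in> parcs G \<longleftrightarrow> (k, j) \<in> parcs G" for j k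
    using arcs_symmetric by blast
  then show ?thesis
    by (intro eq_matI)
      (auto simp: laplacian_def degree_matrix_def adjacency_matrix_def mat_diag_def)
qed

lemma laplacian_mult_ones: "laplacian n G *\<^sub>v ones_vec n = 0\<^sub>v n"
proof (rule eq_vecI)
  fix j assume "j < dim_vec (0\<^sub>v n :: real vec)"
  then have j: "j < n" by simp
  let ?A = "adjacency_matrix n G"
  have A: "?A \<in> carrier_mat n n" by (simp add: adjacency_matrix_def)
  have "(laplacian n G *\<^sub>v ones_vec n) $ j = (\<Sum>k<n. laplacian n G $$ (j, k))"
    using j laplacian_carrier[of n G]
    by (auto simp: scalar_prod_def ones_vec_def atLeast0LessThan)
  also have "\<dots> = (\<Sum>k<n. (if j = k then \<Sum>l<n. ?A $$ (j, l) else 0) - ?A $$ (j, k))"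
    using j A by (intro sum.cong) (auto simp: laplacian_def degree_matrix_def mat_diag_def)
  also have "\<dots> = 0" using j by (simp add: sum_subtractf)
  finally show "(laplacian n G *\<^sub>v ones_vec n) $ j = 0\<^sub>v n $ j" using j by simp
qed (use laplacian_carrier[of n G] in auto)

lemma transpose_gram_update:
  fixes A V :: "real mat"
  assumes A: "A \<in> carrier_mat n n" and sym: "transpose_mat A = A" and V: "V \<in> carrier_mat n c"
  shows "transpose_mat (A + d \<cdot>\<^sub>m (V * transpose_mat V)) = A + d \<cdot>\<^sub>m (V * transpose_mat V)"
proof (rule eq_matI)
  fix j k assume "j < dim_row (A + d \<cdot>\<^sub>m (V * transpose_mat V))"
    "k < dim_col (A + d \<cdot>\<^sub>m (V * transpose_mat V))"
  then have jk: "j < n" "k < n" using V by auto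
  have "A $$ (k, j) = A $$ (j, k)"
    using A jk arg_cong[OF sym, of "\<lambda>M. M $$ (j, k)"] by simp
  moreover have "row V k \<bullet> row V j = row V j \<bullet> row V k"
    by (rule comm_scalar_prod[of _ c]) (rule row_carrier_vec[OF _ V]; fact)+
  moreover have "transpose_mat (A + d \<cdot>\<^sub>m (V * transpose_mat V)) $$ (j, k)
      = A $$ (k, j) + d * (row V k \<bullet> row V j)"
    and "(A + d \<cdot>\<^sub>m (V * transpose_mat V)) $$ (j, k) = A $$ (j, k) + d * (row V j \<bullet> row V k)"
    using A V jk by simp_all
  ultimately show "transpose_mat (A + d \<cdot>\<^sub>m (V * transpose_mat V)) $$ (j, k)
      = (A + d \<cdot>\<^sub>m (V * transpose_mat V)) $$ (j, k)"
    by presburger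
qed (use A V in auto)

lemma gram_update_kernel:
  fixes A V :: "real mat"
  assumes A: "A \<in> carrier_mat n n" and V: "V \<in> carrier_mat n c" and u: "u \<in> carrier_vec n"
    and ker: "A *\<^sub>v u = 0\<^sub>v n" and orth: "transpose_mat V *\<^sub>v u = 0\<^sub>v c"
  shows "(A + d \<cdot>\<^sub>m (V * transpose_mat V)) *\<^sub>v u = 0\<^sub>v n"
proof -
  have Vt: "transpose_mat V \<in> carrier_mat c n" using V by simp
  have "(d \<cdot>\<^sub>m (V * transpose_mat V)) *\<^sub>v u = d \<cdot>\<^sub>v ((V * transpose_mat V) *\<^sub>v u)"
    using V u by (intro eq_vecI) (auto simp del: assoc_mult_mat_vec)
  also have "(V * transpose_mat V) *\<^sub>v u = V *\<^sub>v 0\<^sub>v c"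
    using assoc_mult_mat_vec[OF V Vt u] orth by simp
  also have "\<dots> = 0\<^sub>v n" using V by (intro eq_vecI) auto
  finally show ?thesis
    using add_mult_distrib_mat_vec[OF A _ u, of "d \<cdot>\<^sub>m (V * transpose_mat V)"] V ker
    by (simp add: smult_zero_vec_real)
qed

theorem theorem2p8:
  fixes n c i :: nat
    and G :: "nat pair_pre_digraph"
    and lam :: "nat \<Rightarrow> real" and v :: "nat \<Rightarrow> real vec"
    and \<delta> \<sigma> :: real
    and r zhat z :: "real vec"
    and L V Lhat Vhat :: "real mat"
  assumes graph: "pair_graph G"
    and conn: "Digraph_Component.connected (with_proj G)"
    and verts: "pverts G = {0..<n}"
    and L: "L = laplacian n G"
    and eigenpairs: "\<And>j. j < c \<Longrightarrow> eigenvector L (v j) (lam j)"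
    and lam_pos: "\<And>j. j < c \<Longrightarrow> lam j > 0"
    and unit: "\<And>j. j < c \<Longrightarrow> sqrt (v j \<bullet> v j) = 1"
    and V: "V = mat_of_cols n (map v [0..<c])"
    and delta: "\<delta> > 0"
    and sigma: "\<sigma> > 0"
    and r: "r \<in> carrier_vec n"
    and r_sum: "ones_vec n \<bullet> r = 0"
    and i: "i < n"
    and Lhat: "Lhat = mat_delete L i i"
    and Vhat: "Vhat = row_delete V i"
    and zhat: "zhat \<in> carrier_vec (n - 1)"
    and system: "((Lhat - \<sigma> \<cdot>\<^sub>m 1\<^sub>m (n - 1))
        + (\<sigma> / real n) \<cdot>\<^sub>m outer_prod (ones_vec (n - 1)) (ones_vec (n - 1))
        + \<delta> \<cdot>\<^sub>m (Vhat * transpose_mat Vhat)) *\<^sub>v zhat = vec_delete r i"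
    and z: "z = vec_insert zhat i 0 - ((ones_vec (n - 1) \<bullet> zhat) / real n) \<cdot>\<^sub>v ones_vec n"
  shows "z \<in> carrier_vec n
    \<and> (L + \<delta> \<cdot>\<^sub>m (V * transpose_mat V) - \<sigma> \<cdot>\<^sub>m 1\<^sub>m n) *\<^sub>v z = r
    \<and> ones_vec n \<bullet> z = 0"
proof -
  let ?S = "L + \<delta> \<cdot>\<^sub>m (V * transpose_mat V)"
  have Lc: "L \<in> carrier_mat n n" unfolding L by (rule laplacian_carrier)
  have Lsym: "transpose_mat L = L" unfolding L using graph by (rule laplacian_symmetric)
  have Lker: "L *\<^sub>v ones_vec n = 0\<^sub>v n" unfolding L by (rule laplacian_mult_ones)
  have Vc: "V \<in> carrier_mat n c" unfolding V using mat_of_cols_carrier(1)[of n "map v [0..<c]"] by simp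
  have v: "v j \<in> carrier_vec n" if "j < c" for j
    using eigenpairs[OF that] Lc by (auto simp: eigenvector_def)
  have orth: "transpose_mat V *\<^sub>v ones_vec n = 0\<^sub>v c"
  proof (rule eq_vecI)
    fix j assume "j < dim_vec (0\<^sub>v c :: real vec)"
    then have j: "j < c" by simp
    have "v j \<bullet> ones_vec n = 0"
      using eigenvector_orthogonal_kernel[OF Lc Lsym ones_vec_carrier Lker eigenpairs[OF j]]
        lam_pos[OF j] by simp
    moreover have "col V j = v j" unfolding V using j v by simp
    ultimately show "(transpose_mat V *\<^sub>v ones_vec n) $ j = 0\<^sub>v c $ j" using j Vc by simp
  qed (use Vc in auto)
  have Gc: "V * transpose_mat V \<in> carrier_mat n n" using Vc by simp
  have Sc: "?S \<in> carrier_mat n n" using Lc Vc by simp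
  have Lhc: "Lhat \<in> carrier_mat (n - 1) (n - 1)" unfolding Lhat using Lc by (simp add: mat_delete_def)
  have Vhc: "Vhat \<in> carrier_mat (n - 1) c" unfolding Vhat using Vc by (simp add: row_delete_def)
  have "mat_delete ?S i i = Lhat + \<delta> \<cdot>\<^sub>m (Vhat * transpose_mat Vhat)"
    unfolding Lhat Vhat mat_delete_add_smult[OF Lc Gc i] mat_delete_gram[OF Vc i] ..
  then have "mat_delete ?S i i - \<sigma> \<cdot>\<^sub>m 1\<^sub>m (n - 1)
      + (\<sigma> / real n) \<cdot>\<^sub>m outer_prod (ones_vec (n - 1)) (ones_vec (n - 1))
    = (Lhat - \<sigma> \<cdot>\<^sub>m 1\<^sub>m (n - 1))
      + (\<sigma> / real n) \<cdot>\<^sub>m outer_prod (ones_vec (n - 1)) (ones_vec (n - 1))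
      + \<delta> \<cdot>\<^sub>m (Vhat * transpose_mat Vhat)"
    using Lhc Vhc by (intro eq_matI) (auto simp: outer_prod_def ones_vec_def)
  then have "(mat_delete ?S i i - \<sigma> \<cdot>\<^sub>m 1\<^sub>m (n - 1)
      + (\<sigma> / real n) \<cdot>\<^sub>m outer_prod (ones_vec (n - 1)) (ones_vec (n - 1))) *\<^sub>v zhat
      = vec_delete r i"
    using system by simp
  note solve = grounded_shifted_solve[OF Sc transpose_gram_update[OF Lc Lsym Vc]
      gram_update_kernel[OF Lc Vc ones_vec_carrier Lker orth] r r_sum i zhat this z]
  moreover have "z \<in> carrier_vec n"
    unfolding z using vec_insert_carrier[OF zhat i] by simp
  ultimately show ?thesis by simp
qed

end
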